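(* Let $n\ge 2$ and let $\mathcal{T}$ be a tree on $n$ vertices. For each edge $e\in E(\mathcal{T})$ let $n_1(e)$ and $n_2(e)$ be the numbers of vertices in the two components of the forest $\mathcal{T}\backslash e$ obtained from $\mathcal{T}$ by removing the edge $e$. Then $$\kappa(\mathcal{T})=\frac12\cdot\frac{\sum_{e\in E(\mathcal{T})}(2n_1(e)-1)(2n_2(e)-1)}{n-1}.$$
   Context: Graphs are finite, simple and undirected. Let $G$ be a connected graph with vertex set $\{1,\dots,n\}$, $n\ge2$. Let $m_G$ be its number of edges, $\tau_G$ its number of spanning trees, and $\mathbf{d}_G$ the column vector whose $i$-th entry is the degree of vertex $i$. A 2-tree spanning forest of $G$ is a spanning subgraph that is a forest with exactly two connected components (trees). Let $f^G_{i,j}$ be the number of 2-tree spanning forests of $G$ in which one of the two trees contains $i$ and the other contains $j$ (so $f^G_{i,i}=0$), and let $F_G=[f^G_{i,j}]_{i,j=1}^n$. Kemeny's constant of (the random walk on) $G$ is $$\kappa(G)=\frac{\mathbf{d}_G^TF_G\mathbf{d}_G}{4m_G\tau_G}.$$ *)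

theory Defs
  imports Complex_Main "Jordan_Normal_Form.Matrix"
begin

text \<open>A graph is given by its vertex set and its edge set; an edge is its two-element set of
  end vertices.  A spanning subgraph keeps all vertices, so it is identified with a subset of
  the edges.\<close>

definition simple_graph :: "'a set \<Rightarrow> 'a set set \<Rightarrow> bool" where
  "simple_graph V E \<longleftrightarrow> finite V \<and> (\<forall>e\<in>E. e \<subseteq> V \<and> card e = 2)"

definition adjacency :: "'a set set \<Rightarrow> ('a \<times> 'a) set" where
  "adjacency E = {(u, v). {u, v} \<in> E}"

definition connected_graph :: "'a set \<Rightarrow> 'a set set \<Rightarrow> bool" where
  "connected_graph V E \<longleftrightarrow>
     simple_graph V E \<and> V \<noteq> {} \<and> (\<forall>u\<in>V. \<forall>v\<in>V. (u, v) \<in> (adjacency E)\<^sup>*)"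

text \<open>The vertex sets of the connected components.\<close>

definition graph_components :: "'a set \<Rightarrow> 'a set set \<Rightarrow> 'a set set" where
  "graph_components V E = (\<lambda>v. {u \<in> V. (v, u) \<in> (adjacency E)\<^sup>*}) ` V"

definition graph_cycle :: "'a set set \<Rightarrow> 'a list \<Rightarrow> bool" where
  "graph_cycle E vs \<longleftrightarrow> length vs \<ge> 3 \<and> distinct vs \<and>
     (\<forall>i<length vs. {vs ! i, vs ! (Suc i mod length vs)} \<in> E)"

definition forest_graph :: "'a set \<Rightarrow> 'a set set \<Rightarrow> bool" where
  "forest_graph V E \<longleftrightarrow> simple_graph V E \<and> (\<nexists>vs. graph_cycle E vs)"

definition tree_graph :: "'a set \<Rightarrow> 'a set set \<Rightarrow> bool" where
  "tree_graph V E \<longleftrightarrow> connected_graph V E \<and> forest_graph V E"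

definition graph_degree :: "'a set set \<Rightarrow> 'a \<Rightarrow> nat" where
  "graph_degree E v = card {e \<in> E. v \<in> e}"

definition num_spanning_trees :: "'a set \<Rightarrow> 'a set set \<Rightarrow> nat" where
  "num_spanning_trees V E = card {S. S \<subseteq> E \<and> tree_graph V S}"

definition two_tree_spanning_forests :: "'a set \<Rightarrow> 'a set set \<Rightarrow> 'a set set set" where
  "two_tree_spanning_forests V E =
     {S. S \<subseteq> E \<and> forest_graph V S \<and> card (graph_components V S) = 2}"

definition num_separating_forests :: "'a set \<Rightarrow> 'a set set \<Rightarrow> 'a \<Rightarrow> 'a \<Rightarrow> nat" where
  "num_separating_forests V E i j =
     card {S \<in> two_tree_spanning_forests V E.
             \<exists>A\<in>graph_components V S. \<exists>B\<in>graph_components V S. A \<noteq> B \<and> i \<in> A \<and> j \<in> B}"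

text \<open>Vectors and matrices are indexed from 0 whereas the vertices are 1, ..., n; hence the
  successors.\<close>

definition degree_vec :: "nat \<Rightarrow> nat set set \<Rightarrow> real vec" where
  "degree_vec n E = vec n (\<lambda>i. real (graph_degree E (Suc i)))"

definition forest_mat :: "nat \<Rightarrow> nat set set \<Rightarrow> real mat" where
  "forest_mat n E =
     mat n n (\<lambda>(i, j). real (num_separating_forests {1..n} E (Suc i) (Suc j)))"

definition kemeny_constant :: "nat \<Rightarrow> nat set set \<Rightarrow> real" where
  "kemeny_constant n E =
     (degree_vec n E \<bullet> (forest_mat n E *\<^sub>v degree_vec n E)) /
     (4 * real (card E) * real (num_spanning_trees {1..n} E))"

end

theory Submission
  imports Defs
begin

text \<open>Deleting an edge of a tree is the only way to obtain a 2-tree spanning forest, so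
  \<open>d\<^sup>T F d\<close> is the sum over the edges \<open>e\<close> of twice the product of the degree sums of the two
  components of \<open>T - e\<close>.  A component \<open>C\<close> spans a tree with \<open>card C - 1\<close> edges and meets \<open>e\<close> in
  exactly one vertex, so its degree sum is \<open>2 (card C - 1) + 1\<close>.\<close>

section \<open>Edges, simple paths and bridges\<close>

lemma adjacency_rtrancl_sym: "(u, v) \<in> (adjacency S)\<^sup>* \<Longrightarrow> (v, u) \<in> (adjacency S)\<^sup>*"
  by (erule symD[OF sym_rtrancl, rotated]) (simp add: sym_def adjacency_def insert_commute)

lemma forest_graph_subset: "forest_graph V E \<Longrightarrow> S \<subseteq> E \<Longrightarrow> forest_graph V S"
  unfolding forest_graph_def simple_graph_def graph_cycle_def by blast

lemma simple_graph_finite_edges: "simple_graph V E \<Longrightarrow> finite E"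
  by (rule finite_subset[of E "Pow V"]) (auto simp: simple_graph_def)

lemma simple_graph_edgeE:
  assumes "simple_graph V E" "e \<in> E"
  obtains x y where "e = {x, y}" "x \<noteq> y" "x \<in> V" "y \<in> V"
proof -
  have "e \<subseteq> V" "card e = 2" using assms by (auto simp: simple_graph_def)
  then show thesis using that by (auto simp: card_2_iff)
qed

text \<open>Links the two languages in use: components are defined by reachability, cycles by lists
  of distinct vertices. A walk is built up from its end, and any detour is cut out as soon as a
  vertex recurs.\<close>

lemma rtrancl_distinct_path:
  assumes "(u, v) \<in> r\<^sup>*"
  shows "\<exists>xs. xs \<noteq> [] \<and> hd xs = u \<and> last xs = v \<and> distinct xs \<and>
    successively (\<lambda>x y. (x, y) \<in> r) xs"
  using assms
proof (induction rule: converse_rtrancl_induct)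
  case base
  then show ?case by (intro exI[of _ "[v]"]) auto
next
  case (step u w)
  then obtain xs where xs: "xs \<noteq> []" "hd xs = w" "last xs = v" "distinct xs"
    "successively (\<lambda>x y. (x, y) \<in> r) xs" by blast
  show ?case
  proof (cases "u \<in> set xs")
    case True
    \<comment> \<open>If \<open>u\<close> is already on the path, its suffix from \<open>u\<close>
      on is the path sought, so the new step is dropped.\<close>
    then obtain ys zs where "xs = ys @ u # zs" by (meson split_list)
    with xs show ?thesis
      by (intro exI[of _ "u # zs"]) (auto simp: successively_append_iff)
  next
    case False
    with xs step(1) show ?thesis
      by (intro exI[of _ "u # xs"]) (auto simp: successively_Cons)
  qed
qed

text \<open>A simple path from \<open>u\<close> to \<open>v\<close> avoiding the edge would be
  closed by that edge to a cycle.\<close>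

lemma forest_edge_bridge:
  assumes "forest_graph V E" and e: "{u, v} \<in> E" "u \<noteq> v"
  shows "(u, v) \<notin> (adjacency (E - {{u, v}}))\<^sup>*"
proof
  assume "(u, v) \<in> (adjacency (E - {{u, v}}))\<^sup>*"
  then obtain xs where xs: "xs \<noteq> []" "hd xs = u" "last xs = v" "distinct xs"
    and "successively (\<lambda>x y. (x, y) \<in> adjacency (E - {{u, v}})) xs"
    using rtrancl_distinct_path by metis
  then have step: "{xs ! i, xs ! Suc i} \<in> E - {{u, v}}" if "Suc i < length xs" for i
    using that by (auto simp: successively_conv_nth adjacency_def)
  have u: "xs ! 0 = u" and v: "xs ! (length xs - 1) = v"
    using xs by (auto simp: hd_conv_nth last_conv_nth)
  have "length xs \<noteq> 0" "length xs \<noteq> 1" using xs u v e(2) by auto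
  \<comment> \<open>A path with two vertices would use the edge \<open>{u, v}\<close> itself, which
    has been removed; hence the cycle has the required three vertices.\<close>
  moreover have "length xs \<noteq> 2" using step[of 0] u v by auto
  ultimately have len: "length xs \<ge> 3" by linarith
  have "{xs ! i, xs ! (Suc i mod length xs)} \<in> E" if "i < length xs" for i
  proof (cases "Suc i < length xs")
    case True
    then show ?thesis using step[of i] by simp
  next
    \<comment> \<open>Only the last index is left: \<open>mod\<close> wraps around to
      \<open>u\<close>, and the closing edge is the removed one.\<close>
    case False
    with that have "Suc i = length xs" by simp
    moreover from this have "i = length xs - 1" by simp
    ultimately have "xs ! i = v" "xs ! (Suc i mod length xs) = u" using u v by simp_all
    then show ?thesis using e(1) by (simp add: insert_commute)
  qed
  with len xs(4) have "graph_cycle E xs" by (simp add: graph_cycle_def)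
  with assms(1) show False by (auto simp: forest_graph_def)
qed

section \<open>Connected components and the edge count of forests\<close>

definition component_of :: "'a set \<Rightarrow> 'a set set \<Rightarrow> 'a \<Rightarrow> 'a set" where
  "component_of V E v = {u \<in> V. (v, u) \<in> (adjacency E)\<^sup>*}"

lemma graph_components_eq: "graph_components V E = component_of V E ` V"
  by (simp add: graph_components_def component_of_def[abs_def])

lemma component_of_eq:
  assumes "(u, v) \<in> (adjacency E)\<^sup>*"
  shows "component_of V E u = component_of V E v"
  using rtrancl_trans[OF assms] rtrancl_trans[OF adjacency_rtrancl_sym[OF assms]]
  unfolding component_of_def by blast

lemma component_of_eq_iff:
  assumes "v \<in> V"
  shows "component_of V E u = component_of V E v \<longleftrightarrow> (u, v) \<in> (adjacency E)\<^sup>*"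
proof
  assume "component_of V E u = component_of V E v"
  moreover have "v \<in> component_of V E v" using assms by (simp add: component_of_def)
  ultimately have "v \<in> component_of V E u" by simp
  then show "(u, v) \<in> (adjacency E)\<^sup>*" by (simp add: component_of_def)
qed (rule component_of_eq)

lemma graph_components_memD:
  assumes "C \<in> graph_components V E" "v \<in> C"
  shows "C = component_of V E v \<and> v \<in> V"
proof -
  obtain w where C: "C = component_of V E w" using assms(1) by (auto simp: graph_components_eq)
  with assms(2) have "v \<in> V" "(w, v) \<in> (adjacency E)\<^sup>*" by (auto simp: component_of_def)
  with C show ?thesis using component_of_eq[of w v E V] by simp
qed

lemma graph_components_subset: "C \<in> graph_components V E \<Longrightarrow> C \<subseteq> V"
  unfolding graph_components_def by auto

lemma Union_graph_components: "\<Union> (graph_components V E) = V"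
  unfolding graph_components_eq component_of_def by auto

text \<open>A walk needs the new edge at most once, in one of its two directions. The edge
  contributes two ordered pairs, so \<open>rtrancl_insert\<close> is applied twice; transitivity
  absorbs the surplus cases.\<close>

lemma adjacency_insert_rtrancl:
  "(u, v) \<in> (adjacency (insert {x, y} S))\<^sup>* \<longleftrightarrow>
    (u, v) \<in> (adjacency S)\<^sup>* \<or>
    (u, x) \<in> (adjacency S)\<^sup>* \<and> (y, v) \<in> (adjacency S)\<^sup>* \<or>
    (u, y) \<in> (adjacency S)\<^sup>* \<and> (x, v) \<in> (adjacency S)\<^sup>*"
proof -
  let ?R = "(adjacency S)\<^sup>*"
  have "adjacency (insert {x, y} S) = insert (x, y) (insert (y, x) (adjacency S))"
    by (auto simp: adjacency_def doubleton_eq_iff)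
  then have "(u, v) \<in> (adjacency (insert {x, y} S))\<^sup>* \<longleftrightarrow>
      ((u, v) \<in> ?R \<or> (u, y) \<in> ?R \<and> (x, v) \<in> ?R) \<or>
      ((u, x) \<in> ?R \<or> (u, y) \<in> ?R \<and> (x, x) \<in> ?R) \<and> ((y, v) \<in> ?R \<or> (y, y) \<in> ?R \<and> (x, v) \<in> ?R)"
    by (simp only: rtrancl_insert Un_iff mem_Collect_eq prod.case)
  moreover have "(u, v) \<in> ?R" if "(u, w) \<in> ?R" "(w, v) \<in> ?R" for w
    using that by (rule rtrancl_trans)
  ultimately show ?thesis by auto
qed

text \<open>Stated as a function of \<open>C v\<close> alone, so that all new components can be read
  off as an image of the old ones. If \<open>C x = C y\<close>, the union is that same component and
  nothing changes.\<close>

lemma component_of_insert: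
  fixes S :: "'a set set"
  assumes "v \<in> V" "x \<in> V" "y \<in> V"
  defines "C \<equiv> component_of V S"
  shows "component_of V (insert {x, y} S) v = (if C v \<in> {C x, C y} then C x \<union> C y else C v)"
proof -
  let ?R = "(adjacency S)\<^sup>*"
  have eq: "C v = C x \<longleftrightarrow> (v, x) \<in> ?R" "C v = C y \<longleftrightarrow> (v, y) \<in> ?R"
    unfolding C_def using assms(1-3) by (simp_all add: component_of_eq_iff)
  have mem: "u \<in> C w \<longleftrightarrow> u \<in> V \<and> (w, u) \<in> ?R" for u w
    by (simp add: C_def component_of_def)
  have *: "component_of V (insert {x, y} S) v =
      C v \<union> (if C v = C x then C y else {}) \<union> (if C v = C y then C x else {})"
    unfolding eq using mem by (auto simp: component_of_def adjacency_insert_rtrancl)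
  show ?thesis
    unfolding * by (cases "C v = C x"; cases "C v = C y") auto
qed

text \<open>Add the edges one at a time: in a forest each new edge joins two different components,
  so every edge lowers the number of components by exactly one, starting from \<open>card V\<close>
  singletons.\<close>

lemma forest_card_components:
  assumes "forest_graph V S"
  shows "card (graph_components V S) + card S = card V"
proof -
  have "finite S" using assms simple_graph_finite_edges by (auto simp: forest_graph_def)
  then show ?thesis using assms
  proof (induction S)
    case empty
    have "adjacency ({} :: 'a set set) = {}" by (auto simp: adjacency_def)
    then have "component_of V {} v = {v}" if "v \<in> V" for v
      using that by (auto simp: component_of_def)
    then have "graph_components V {} = (\<lambda>v. {v}) ` V" by (simp add: graph_components_eq)
    then show ?case by (simp add: card_image)
  next
    case (insert e S)
    have simple: "simple_graph V (insert e S)" and fin: "finite V"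
      using insert.prems by (auto simp: forest_graph_def simple_graph_def)
    obtain x y where e: "e = {x, y}" "x \<noteq> y" and V: "x \<in> V" "y \<in> V"
      using simple_graph_edgeE[OF simple] by blast
    define C where "C = component_of V S"
    define K where "K = graph_components V S"
    have IH: "card K + card S = card V"
      unfolding K_def using insert.IH forest_graph_subset[OF insert.prems] by blast
    \<comment> \<open>As \<open>e\<close> is not in \<open>S\<close>, deleting it from
      \<open>insert e S\<close> gives back \<open>S\<close>, and the bridge property
      applies.\<close>
    have "(x, y) \<notin> (adjacency S)\<^sup>*"
      using forest_edge_bridge[OF insert.prems, of x y] e insert.hyps by simp
    then have Cxy: "C x \<noteq> C y" using component_of_eq_iff[OF V(2)] by (simp add: C_def)
    have K: "K = C ` V" by (simp add: K_def C_def graph_components_eq)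
    have "graph_components V (insert e S) =
        (\<lambda>v. if C v \<in> {C x, C y} then C x \<union> C y else C v) ` V"
      unfolding graph_components_eq e(1)
      by (rule image_cong[OF refl]) (simp add: component_of_insert V C_def)
    also have "\<dots> = insert (C x \<union> C y) (K - {C x, C y})"
      using V by (auto simp: K)
    finally have comps: "graph_components V (insert e S) = insert (C x \<union> C y) (K - {C x, C y})" .
    \<comment> \<open>The merged set must be new for the count to be right: the only old component
      containing \<open>x\<close> is \<open>C x\<close>, which has been taken out.\<close>
    have "C x \<union> C y \<notin> K - {C x, C y}"
    proof
      assume *: "C x \<union> C y \<in> K - {C x, C y}"
      then have "C x \<union> C y \<in> graph_components V S" by (simp only: K_def Diff_iff)
      moreover have "x \<in> C x \<union> C y" using V by (simp add: C_def component_of_def)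
      ultimately have "C x \<union> C y = C x"
        unfolding C_def by (blast dest: graph_components_memD)
      with * show False by simp
    qed
    moreover have "finite K" "{C x, C y} \<subseteq> K" using fin V by (auto simp: K)
    moreover have "card {C x, C y} = 2" using Cxy by simp
    \<comment> \<open>This bound keeps the natural subtraction \<open>card K - 2\<close> from being
      truncated.\<close>
    moreover have "card {C x, C y} \<le> card K" by (rule card_mono) fact+
    ultimately have "card (graph_components V (insert e S)) = card K - 2 + 1" "card K \<ge> 2"
      by (simp_all add: comps card_Diff_subset)
    with IH insert.hyps show ?case by simp
  qed
qed

section \<open>Spanning trees and 2-tree spanning forests of a tree\<close>

lemma connected_graph_components: "connected_graph V E \<Longrightarrow> graph_components V E = {V}"
  unfolding connected_graph_def graph_components_def by auto

lemma tree_card_edges: "tree_graph V E \<Longrightarrow> Suc (card E) = card V"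
  using forest_card_components[of V E] connected_graph_components[of V E]
  by (simp add: tree_graph_def)

lemma tree_graph_finite_edges: "tree_graph V E \<Longrightarrow> finite E"
  using simple_graph_finite_edges by (auto simp: tree_graph_def forest_graph_def)

text \<open>All trees on \<open>V\<close> have the same number of edges, so a spanning tree inside
  the finite set \<open>E\<close> must be all of \<open>E\<close>.\<close>

lemma num_spanning_trees_tree:
  assumes "tree_graph V E"
  shows "num_spanning_trees V E = 1"
proof -
  have "S = E" if "S \<subseteq> E" "tree_graph V S" for S
    using tree_card_edges[OF assms] tree_card_edges[OF that(2)] that(1)
      tree_graph_finite_edges[OF assms] by (metis card_subset_eq nat.inject)
  then have "{S. S \<subseteq> E \<and> tree_graph V S} = {E}" using assms by auto
  then show ?thesis by (simp add: num_spanning_trees_def)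
qed

lemma card_components_tree_delete_edge:
  assumes "tree_graph V E" "e \<in> E"
  shows "card (graph_components V (E - {e})) = 2"
proof -
  have "forest_graph V (E - {e})"
    using assms(1) forest_graph_subset[of V E] by (simp add: tree_graph_def)
  from forest_card_components[OF this] show ?thesis
    using card_Suc_Diff1[OF tree_graph_finite_edges[OF assms(1)] assms(2)]
      tree_card_edges[OF assms(1)] by linarith
qed

text \<open>By the edge count, a subforest of \<open>E\<close> has two components exactly when it
  has one edge fewer than \<open>E\<close>.\<close>

lemma two_tree_spanning_forests_tree:
  assumes "tree_graph V E"
  shows "two_tree_spanning_forests V E = (\<lambda>e. E - {e}) ` E"
proof
  have forest: "forest_graph V S" if "S \<subseteq> E" for S
    using assms that forest_graph_subset[of V E] by (simp add: tree_graph_def)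
  show "(\<lambda>e. E - {e}) ` E \<subseteq> two_tree_spanning_forests V E"
    using card_components_tree_delete_edge[OF assms]
    by (auto simp: two_tree_spanning_forests_def intro: forest)
  show "two_tree_spanning_forests V E \<subseteq> (\<lambda>e. E - {e}) ` E"
  proof
    fix S assume "S \<in> two_tree_spanning_forests V E"
    then have S: "S \<subseteq> E" "card (graph_components V S) = 2"
      by (auto simp: two_tree_spanning_forests_def)
    have fin: "finite E" using assms by (rule tree_graph_finite_edges)
    have "card S + 2 = card V" using forest_card_components[OF forest[OF S(1)]] S(2) by simp
    then have "card (E - S) = 1"
      using tree_card_edges[OF assms] card_Diff_subset[OF finite_subset[OF S(1) fin] S(1)]
      by simp
    then obtain e where "E - S = {e}" by (auto simp: card_1_singleton_iff)
    then have "e \<in> E" "S = E - {e}" using S(1) by auto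
    then show "S \<in> (\<lambda>e. E - {e}) ` E" by blast
  qed
qed

text \<open>Distinct edges of \<open>E\<close> leave distinct forests, so separating forests can be
  counted by their missing edge.\<close>

lemma num_separating_forests_tree:
  assumes "tree_graph V E"
  shows "num_separating_forests V E i j =
    card {e \<in> E. \<exists>A\<in>graph_components V (E - {e}). \<exists>B\<in>graph_components V (E - {e}).
      A \<noteq> B \<and> i \<in> A \<and> j \<in> B}" (is "_ = card {e \<in> E. ?P (E - {e})}")
proof -
  have "{S \<in> two_tree_spanning_forests V E. ?P S} = (\<lambda>e. E - {e}) ` {e \<in> E. ?P (E - {e})}"
    unfolding two_tree_spanning_forests_tree[OF assms] by blast
  moreover have "inj_on (\<lambda>e. E - {e}) {e \<in> E. ?P (E - {e})}"
    by (rule inj_onI) blast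
  ultimately show ?thesis by (simp add: num_separating_forests_def card_image)
qed

section \<open>Degree sums over the components left by deleting an edge\<close>

text \<open>Since \<open>e\<close> is a bridge, its ends lie in different components of
  \<open>E - {e}\<close>; as there are only two components, each one contains exactly one
  end.\<close>

lemma tree_delete_edge_component_Int:
  assumes "tree_graph V E" "e \<in> E" "C \<in> graph_components V (E - {e})"
  shows "card (e \<inter> C) = 1"
proof -
  have forest: "forest_graph V E" and "simple_graph V E"
    using assms(1) by (auto simp: tree_graph_def forest_graph_def)
  then obtain x y where e: "e = {x, y}" "x \<noteq> y" and V: "x \<in> V" "y \<in> V"
    using simple_graph_edgeE assms(2) by metis
  define D where "D = component_of V (E - {e})"
  have ne: "D x \<noteq> D y"
    using forest_edge_bridge[OF forest, of x y] e assms(2) component_of_eq_iff[OF V(2)]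
    by (simp add: D_def)
  have two: "card (graph_components V (E - {e})) = 2"
    using card_components_tree_delete_edge assms by blast
  moreover have "{D x, D y} \<subseteq> graph_components V (E - {e})"
    using V by (auto simp: D_def graph_components_eq)
  ultimately have "graph_components V (E - {e}) = {D x, D y}"
    \<comment> \<open>An infinite set has cardinality 0, so cardinality 2 supplies the finiteness
      needed to identify the two-element subset with the whole.\<close>
    using ne by (metis card_2_iff card_subset_eq card.infinite zero_neq_numeral)
  then have "C = D x \<or> C = D y" using assms(3) by auto
  moreover have "x \<in> D x" "y \<in> D y" using V by (auto simp: D_def component_of_def)
  moreover have "y \<notin> D x" "x \<notin> D y"
    using ne component_of_eq_iff[OF V(2), of "E - {e}"] component_of_eq_iff[OF V(1), of "E - {e}"]
    unfolding D_def by (auto simp: component_of_def)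
  ultimately have "e \<inter> C = {x} \<or> e \<inter> C = {y}" using e by auto
  then show ?thesis by auto
qed

lemma graph_component_edge_cases:
  assumes "simple_graph V S" "C \<in> graph_components V S" "f \<in> S"
  shows "f \<subseteq> C \<or> f \<inter> C = {}"
proof -
  obtain x y where f: "f = {x, y}" and V: "x \<in> V" "y \<in> V"
    using simple_graph_edgeE[OF assms(1,3)] by metis
  have "(x, y) \<in> (adjacency S)\<^sup>*" using assms(3) f by (auto simp: adjacency_def)
  then have "component_of V S x = component_of V S y" by (rule component_of_eq)
  moreover have "x \<in> component_of V S x" "y \<in> component_of V S y"
    using V by (auto simp: component_of_def)
  ultimately have "x \<in> C \<longleftrightarrow> y \<in> C"
    using graph_components_memD[OF assms(2)] by blast
  then show ?thesis using f by auto
qed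

text \<open>The component with the edges inside it is itself a tree on the vertex set
  \<open>C\<close>, so the edge count of trees applies to it.\<close>

lemma card_edges_in_component:
  assumes "forest_graph V S" "C \<in> graph_components V S"
  shows "Suc (card {f \<in> S. f \<subseteq> C}) = card C"
proof -
  define S' where "S' = {f \<in> S. f \<subseteq> C}"
  have simple: "simple_graph V S" using assms(1) by (simp add: forest_graph_def)
  have "C \<subseteq> V" using assms(2) by (rule graph_components_subset)
  have ne: "C \<noteq> {}" using assms(2) by (auto simp: graph_components_def)
  have simple': "simple_graph C S'"
    using simple \<open>C \<subseteq> V\<close> by (auto simp: simple_graph_def S'_def intro: finite_subset)
  have forest': "forest_graph C S'"
    using simple' forest_graph_subset[OF assms(1), of S'] by (auto simp: forest_graph_def S'_def)
  \<comment> \<open>Carrying \<open>v \<in> C\<close> through the induction shows that a walk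
    starting in \<open>C\<close> never leaves it, so each of its edges belongs to
    \<open>S'\<close>.\<close>
  have reach: "(u, v) \<in> (adjacency S')\<^sup>* \<and> v \<in> C" if "(u, v) \<in> (adjacency S)\<^sup>*" "u \<in> C" for u v
    using that
  proof (induction rule: rtrancl_induct)
    case (step v w)
    then have "{v, w} \<in> S" "v \<in> C" by (auto simp: adjacency_def)
    then have "{v, w} \<in> S'" "w \<in> C"
      using graph_component_edge_cases[OF simple assms(2), of "{v, w}"] by (auto simp: S'_def)
    then show ?case
      using step by (auto simp: adjacency_def intro: rtrancl_into_rtrancl)
  qed auto
  have "(u, v) \<in> (adjacency S')\<^sup>*" if "u \<in> C" "v \<in> C" for u v
    using graph_components_memD[OF assms(2) that(1)] reach[of u v] that
    by (auto simp: component_of_def)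
  then have "tree_graph C S'"
    using simple' forest' ne by (simp add: tree_graph_def connected_graph_def)
  then show ?thesis using tree_card_edges by (auto simp: S'_def)
qed

text \<open>Double counting of the incidences between \<open>A\<close> and \<open>E\<close>: the
  handshake argument restricted to a vertex set.\<close>

lemma sum_graph_degree:
  assumes "finite A" "finite E"
  shows "(\<Sum>v\<in>A. graph_degree E v) = (\<Sum>f\<in>E. card (f \<inter> A))"
proof -
  have "(\<Sum>v\<in>A. graph_degree E v) = (\<Sum>v\<in>A. \<Sum>f\<in>E. if v \<in> f then 1 else 0)"
    using assms by (simp add: graph_degree_def sum.If_cases Int_def)
  also have "\<dots> = (\<Sum>f\<in>E. \<Sum>v\<in>A. if v \<in> f then 1 else 0)" by (rule sum.swap)
  also have "\<dots> = (\<Sum>f\<in>E. card (f \<inter> A))"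
    using assms by (simp add: sum.If_cases Int_commute)
  finally show ?thesis .
qed

lemma tree_delete_edge_component_degree_sum:
  assumes "tree_graph V E" "e \<in> E" "C \<in> graph_components V (E - {e})"
  shows "Suc (\<Sum>v\<in>C. graph_degree E v) = 2 * card C"
proof -
  define S where "S = E - {e}"
  have simple: "simple_graph V S" and forest: "forest_graph V S"
    using assms(1) forest_graph_subset[of V E S]
    by (auto simp: tree_graph_def forest_graph_def S_def)
  have C: "C \<in> graph_components V S" using assms(3) by (simp add: S_def)
  have finE: "finite E" using assms(1) by (rule tree_graph_finite_edges)
  have "C \<subseteq> V" using C by (rule graph_components_subset)
  with simple have finC: "finite C" by (auto simp: simple_graph_def intro: finite_subset)
  \<comment> \<open>No remaining edge crosses the boundary of \<open>C\<close>, so it contributes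
    both of its ends or none; only the deleted \<open>e\<close> contributes a single one.\<close>
  have "card (f \<inter> C) = (if f \<subseteq> C then 2 else 0)" if "f \<in> S" for f
    using graph_component_edge_cases[OF simple C that] simple that
    by (auto simp: simple_graph_def Int_absorb2)
  then have "(\<Sum>f\<in>S. card (f \<inter> C)) = (\<Sum>f\<in>S. if f \<subseteq> C then 2 else 0)" by simp
  also have "\<dots> = 2 * card {f \<in> S. f \<subseteq> C}"
    using finE by (simp add: sum.If_cases S_def Int_def)
  finally have "(\<Sum>f\<in>S. card (f \<inter> C)) = 2 * card {f \<in> S. f \<subseteq> C}" .
  moreover have "(\<Sum>v\<in>C. graph_degree E v) = card (e \<inter> C) + (\<Sum>f\<in>S. card (f \<inter> C))"
    using sum.remove[OF finE assms(2)] by (simp add: sum_graph_degree finC finE S_def)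
  moreover have "card (e \<inter> C) = 1" using assms by (rule tree_delete_edge_component_Int)
  ultimately show ?thesis using card_edges_in_component[OF forest C] by simp
qed

section \<open>Evaluation of the quadratic form and of Kemeny's constant\<close>

lemma degree_forest_quadratic_form:
  "degree_vec n E \<bullet> (forest_mat n E *\<^sub>v degree_vec n E) =
    (\<Sum>i\<in>{1..n}. \<Sum>j\<in>{1..n}. real (num_separating_forests {1..n} E i j) *
      (real (graph_degree E i) * real (graph_degree E j)))"
  by (simp add: sum.atLeast1_atMost_eq scalar_prod_def degree_vec_def forest_mat_def sum_distrib_left
      atLeast0LessThan mult_ac)

text \<open>A row with \<open>i \<in> A\<close> sees only columns in \<open>B\<close>, and vice
  versa. Ordered pairs are summed, so the product of the two sums appears twice.\<close>

lemma sum_separated_pairs: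
  fixes g :: "'a \<Rightarrow> real"
  assumes "finite V" "A \<union> B = V" "A \<inter> B = {}"
  shows "(\<Sum>i\<in>V. \<Sum>j\<in>V. if i \<in> A \<and> j \<in> B \<or> i \<in> B \<and> j \<in> A then g i * g j else 0) =
    2 * (sum g A * sum g B)"
proof -
  have fin: "finite A" "finite B" using assms by auto
  have split: "(\<Sum>i\<in>V. h i) = (\<Sum>i\<in>A. h i) + (\<Sum>i\<in>B. h i)" for h :: "'a \<Rightarrow> real"
    using sum.union_disjoint[OF fin assms(3)] assms(2) by simp
  define h where "h i = (\<Sum>j\<in>V. if i \<in> A \<and> j \<in> B \<or> i \<in> B \<and> j \<in> A then g i * g j else 0)" for i
  have A: "h i = g i * sum g B" if "i \<in> A" for i
  proof -
    have "i \<notin> B" "\<forall>j\<in>A. j \<notin> B" using that assms(3) by auto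
    with that show ?thesis by (simp add: h_def split sum_distrib_left)
  qed
  have B: "h i = g i * sum g A" if "i \<in> B" for i
  proof -
    have "i \<notin> A" "\<forall>j\<in>B. j \<notin> A" using that assms(3) by auto
    with that show ?thesis by (simp add: h_def split sum_distrib_left)
  qed
  have "sum h V = 2 * (sum g A * sum g B)"
    by (simp add: split A B flip: sum_distrib_right)
  then show ?thesis by (simp add: h_def)
qed

theorem mainTheorem2:
  fixes n :: nat and E :: "nat set set" and n1 n2 :: "nat set \<Rightarrow> nat"
  assumes "n \<ge> 2"
    and "tree_graph {1..n} E"
    and "\<And>e. e \<in> E \<Longrightarrow>
      \<exists>A B. A \<noteq> B \<and> graph_components {1..n} (E - {e}) = {A, B} \<and> n1 e = card A \<and> n2 e = card B"
  shows "kemeny_constant n E =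
    1 / 2 * ((\<Sum>e\<in>E. (2 * real (n1 e) - 1) * (2 * real (n2 e) - 1)) / (real n - 1))"
proof -
  define V where "V = {1..n}"
  have tree: "tree_graph V E" and finV: "finite V" using assms(2) by (auto simp: V_def)
  have finE: "finite E" using tree by (rule tree_graph_finite_edges)
  define d where "d v = real (graph_degree E v)" for v
  define sep where "sep e i j \<longleftrightarrow> (\<exists>A\<in>graph_components V (E - {e}).
    \<exists>B\<in>graph_components V (E - {e}). A \<noteq> B \<and> i \<in> A \<and> j \<in> B)" for e i j
  have edge: "(\<Sum>i\<in>V. \<Sum>j\<in>V. if sep e i j then d i * d j else 0) =
      2 * ((2 * real (n1 e) - 1) * (2 * real (n2 e) - 1))" if e: "e \<in> E" for e
  proof -
    obtain A B where AB: "A \<noteq> B" "graph_components V (E - {e}) = {A, B}"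
      and n12: "n1 e = card A" "n2 e = card B"
      using assms(3)[OF e] unfolding V_def by blast
    have "A \<union> B = V" using Union_graph_components[of V "E - {e}"] AB by simp
    moreover have "A \<inter> B = {}"
      using graph_components_memD[of A V "E - {e}"] graph_components_memD[of B V "E - {e}"] AB
      by blast
    moreover have "sep e i j \<longleftrightarrow> i \<in> A \<and> j \<in> B \<or> i \<in> B \<and> j \<in> A" for i j
      using AB by (auto simp: sep_def)
    moreover have "sum d C = 2 * real (card C) - 1" if "C \<in> {A, B}" for C
    proof -
      have "Suc (\<Sum>v\<in>C. graph_degree E v) = 2 * card C"
        using tree_delete_edge_component_degree_sum[OF tree e] AB that by simp
      \<comment> \<open>The cast precedes the subtraction, so that 1 is subtracted in the
        reals.\<close>
      then have "real (Suc (\<Sum>v\<in>C. graph_degree E v)) = real (2 * card C)" by simp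
      then show ?thesis by (simp add: d_def)
    qed
    ultimately show ?thesis
      using sum_separated_pairs[OF finV, of A B d] by (simp add: n12)
  qed
  \<comment> \<open>The edge count becomes a sum of indicators over \<open>E\<close>, so that the
    sum over edges can be moved outside the sums over vertices.\<close>
  have count: "real (num_separating_forests V E i j) * x = (\<Sum>e\<in>E. if sep e i j then x else 0)"
    for i j x
    using finE unfolding num_separating_forests_tree[OF tree] sep_def[symmetric]
    by (simp add: sum.If_cases Int_def)
  have "degree_vec n E \<bullet> (forest_mat n E *\<^sub>v degree_vec n E) =
      (\<Sum>i\<in>V. \<Sum>j\<in>V. \<Sum>e\<in>E. if sep e i j then d i * d j else 0)"
    unfolding degree_forest_quadratic_form V_def[symmetric] d_def[symmetric] count ..
  also have "\<dots> = (\<Sum>e\<in>E. \<Sum>i\<in>V. \<Sum>j\<in>V. if sep e i j then d i * d j else 0)"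
    by (simp add: sum.swap[of _ E])
  also have "\<dots> = 2 * (\<Sum>e\<in>E. (2 * real (n1 e) - 1) * (2 * real (n2 e) - 1))"
    by (simp add: edge sum_distrib_left)
  finally have "degree_vec n E \<bullet> (forest_mat n E *\<^sub>v degree_vec n E) = \<dots>" .
  moreover have "real (card E) = real n - 1"
    using tree_card_edges[OF tree] by (simp add: V_def)
  moreover have "num_spanning_trees {1..n} E = 1"
    using num_spanning_trees_tree[OF assms(2)] .
  \<comment> \<open>The 2 from ordered pairs against the 4 in the definition leaves the factor 1/2;
    \<open>real 1\<close> is the number of spanning trees.\<close>
  moreover have "2 * x / (4 * k * real 1) = 1 / 2 * (x / k)" for x k :: real by simp
  ultimately show ?thesis by (simp only: kemeny_constant_def)
qed

end
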